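(* Let $\omega>0$ and $T>0$. Suppose that the source term $g$ admits a finite spectral decomposition $g=\sum_{k} g_k\Phi_k$ (finite sum) in eigenfunctions $\Phi_k$ of $\mathcal{H}$, and that $\lambda^*=\min_k \operatorname{Im}(\lambda_k)>0$. Then the fixed-point iteration $v^{(0)}=0$, $v^{(n+1)}=\mathcal{S}_{T,g}v^{(n)}$ converges, and its limit $u$ solves the Helmholtz problem $$\omega^2u+\mathcal{H}u=-g \text{ in } \Omega^{\#},\qquad u=0 \text{ on } \partial\Omega^{\#}.$$
   Context: $\Omega^{\#}\subset\mathbb{R}^d$ is a bounded domain containing a domain $\Omega$; $c(x)>0$ is the wave speed; $W(x)\ge 0$ is a smooth function vanishing in $\Omega$; and $\mathcal{H}u := c^2(x)\Delta u+\mathrm{i}W(x)u$, with homogeneous Dirichlet condition $u=0$ on $\partial\Omega^{\#}$. The $\Phi_k$ are (linearly independent) eigenfunctions of $\mathcal{H}$ vanishing on $\partial\Omega^{\#}$, with complex eigenvalues $\lambda_k$: $\mathcal{H}\Phi_k=\lambda_k\Phi_k$. The notation is $\lambda^*:=\min_k\operatorname{Im}(\lambda_k)$. For given $v$, define $\mathcal{S}_{T,g}v:=\exp(\mathrm{i}\omega^2T)\,\tilde v(T)$, where $\tilde v(t)$ solves the abstract ordinary differential equation $$\partial_t\tilde v-\mathrm{i}\mathcal{H}\tilde v=\mathrm{i}g\exp(-\mathrm{i}\omega^2t)\quad\text{for } t\in(0,T),\qquad \tilde v(0)=v.$$ For $v=\sum_k v_k\Phi_k$ and $g=\sum_k g_k\Phi_k$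 (finite sums), the solution is understood through the spectral expansion, i.e. $\tilde v(t)=\sum_k\tilde v_k(t)\Phi_k$ where each coefficient solves the scalar equation $\tilde v_k'-\mathrm{i}\lambda_k\tilde v_k=\mathrm{i}g_k\exp(-\mathrm{i}\omega^2t)$, $\tilde v_k(0)=v_k$. Convergence is in the finite-dimensional span of the $\Phi_k$ occurring in the decomposition of $g$ (equivalently, of each coefficient). *)

theory Defs
  imports "HOL-Analysis.Analysis"
begin

definition is_domain :: "'a::euclidean_space set \<Rightarrow> bool" where
  "is_domain D \<longleftrightarrow> open D \<and> connected D \<and> D \<noteq> {}"

definition partial :: "'a::euclidean_space \<Rightarrow> ('a \<Rightarrow> 'b::real_normed_vector) \<Rightarrow> 'a \<Rightarrow> 'b" where
  "partial b f x = frechet_derivative f (at x) b"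

text \<open>The set \<open>D\<close> is meant to be open.\<close>

primrec Ck_on :: "nat \<Rightarrow> 'a::euclidean_space set \<Rightarrow> ('a \<Rightarrow> 'b::real_normed_vector) \<Rightarrow> bool" where
  "Ck_on 0 D f = continuous_on D f"
| "Ck_on (Suc n) D f = (f differentiable_on D \<and> (\<forall>b\<in>Basis. Ck_on n D (partial b f)))"

definition smooth_on :: "'a::euclidean_space set \<Rightarrow> ('a \<Rightarrow> 'b::real_normed_vector) \<Rightarrow> bool" where
  "smooth_on D f \<longleftrightarrow> (\<forall>n. Ck_on n D f)"

definition laplacian :: "('a::euclidean_space \<Rightarrow> complex) \<Rightarrow> 'a \<Rightarrow> complex" where
  "laplacian u x = (\<Sum>b\<in>Basis. partial b (partial b u) x)"

definition H_op :: "('a::euclidean_space \<Rightarrow> real) \<Rightarrow> ('a \<Rightarrow> real) \<Rightarrow> ('a \<Rightarrow> complex) \<Rightarrow> 'a \<Rightarrow> complex" where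
  "H_op c W u x = of_real ((c x)\<^sup>2) * laplacian u x + \<i> * of_real (W x) * u x"

text \<open>Equations and boundary conditions are understood classically. A function on the closure of
  \<open>D\<close> is represented by a function on the whole space; its values elsewhere are irrelevant.\<close>

definition dirichlet_function :: "'a::euclidean_space set \<Rightarrow> ('a \<Rightarrow> complex) \<Rightarrow> bool" where
  "dirichlet_function D u \<longleftrightarrow>
     Ck_on 2 D u \<and> continuous_on (closure D) u \<and> (\<forall>x\<in>frontier D. u x = 0)"

definition eigenfunction ::
  "'a::euclidean_space set \<Rightarrow> ('a \<Rightarrow> real) \<Rightarrow> ('a \<Rightarrow> real) \<Rightarrow> complex \<Rightarrow> ('a \<Rightarrow> complex) \<Rightarrow> bool" where
  "eigenfunction D c W lam u \<longleftrightarrow>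
     dirichlet_function D u \<and> (\<exists>x\<in>D. u x \<noteq> 0) \<and> (\<forall>x\<in>D. H_op c W u x = lam * u x)"

definition solves_helmholtz ::
  "'a::euclidean_space set \<Rightarrow> ('a \<Rightarrow> real) \<Rightarrow> ('a \<Rightarrow> real) \<Rightarrow> real \<Rightarrow> ('a \<Rightarrow> complex) \<Rightarrow> ('a \<Rightarrow> complex) \<Rightarrow> bool" where
  "solves_helmholtz D c W \<omega> g u \<longleftrightarrow>
     dirichlet_function D u \<and> (\<forall>x\<in>D. of_real (\<omega>\<^sup>2) * u x + H_op c W u x = - g x)"

definition lin_indep_on :: "'a set \<Rightarrow> 'k set \<Rightarrow> ('k \<Rightarrow> 'a \<Rightarrow> complex) \<Rightarrow> bool" where
  "lin_indep_on D I \<Phi> \<longleftrightarrow>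
     (\<forall>K a. finite K \<longrightarrow> K \<subseteq> I \<longrightarrow> (\<forall>x\<in>D. (\<Sum>k\<in>K. a k * \<Phi> k x) = 0) \<longrightarrow> (\<forall>k\<in>K. a k = 0))"

definition expansion_on ::
  "'a set \<Rightarrow> 'k set \<Rightarrow> ('k \<Rightarrow> 'a \<Rightarrow> complex) \<Rightarrow> ('k \<Rightarrow> complex) \<Rightarrow> ('a \<Rightarrow> complex) \<Rightarrow> bool" where
  "expansion_on D K \<Phi> a f \<longleftrightarrow> (\<forall>x\<in>D. f x = (\<Sum>k\<in>K. a k * \<Phi> k x))"

definition lambda_star :: "'k set \<Rightarrow> ('k \<Rightarrow> complex) \<Rightarrow> real" where
  "lambda_star K lam = Min ((\<lambda>k. Im (lam k)) ` K)"

text \<open>\<open>w\<close> solves, through its spectral expansion, the abstract equation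
  \<open>w' - \<i> H w = \<i> g exp (- \<i> \<omega>\<^sup>2 t)\<close> on \<open>(0,T)\<close> with \<open>w 0 = v\<close>. A common finite index set
  \<open>K\<close> for \<open>v\<close> and \<open>g\<close> is no restriction, as coefficients may vanish. The formula for
  \<open>w\<close> is imposed on the whole space, so that under linear independence of \<open>\<Phi>\<close> on
  \<open>D\<close> the value \<open>w T\<close> is unique as a function, as \<open>THE\<close> below requires.\<close>

definition spectral_solution ::
  "'a set \<Rightarrow> 'k set \<Rightarrow> ('k \<Rightarrow> 'a \<Rightarrow> complex) \<Rightarrow> ('k \<Rightarrow> complex) \<Rightarrow> real \<Rightarrow> real \<Rightarrow>
   ('a \<Rightarrow> complex) \<Rightarrow> ('a \<Rightarrow> complex) \<Rightarrow> (real \<Rightarrow> 'a \<Rightarrow> complex) \<Rightarrow> bool" where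
  "spectral_solution D I \<Phi> lam \<omega> T g v w \<longleftrightarrow>
     (\<exists>K gc vc wc. finite K \<and> K \<subseteq> I \<and> expansion_on D K \<Phi> gc g \<and> expansion_on D K \<Phi> vc v \<and>
        (\<forall>k\<in>K. continuous_on {0..T} (wc k) \<and> wc k 0 = vc k \<and>
           (\<forall>t\<in>{0<..<T}. \<exists>w'. (wc k has_vector_derivative w') (at t) \<and>
              w' - \<i> * lam k * wc k t = \<i> * gc k * exp (- (\<i> * of_real (\<omega>\<^sup>2 * t))))) \<and>
        (\<forall>t\<in>{0..T}. expansion_on UNIV K \<Phi> (\<lambda>k. wc k t) (w t)))"

definition S_op ::
  "'a set \<Rightarrow> 'k set \<Rightarrow> ('k \<Rightarrow> 'a \<Rightarrow> complex) \<Rightarrow> ('k \<Rightarrow> complex) \<Rightarrow> real \<Rightarrow> real \<Rightarrow>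
   ('a \<Rightarrow> complex) \<Rightarrow> ('a \<Rightarrow> complex) \<Rightarrow> 'a \<Rightarrow> complex" where
  "S_op D I \<Phi> lam \<omega> T g v =
     (\<lambda>x. exp (\<i> * of_real (\<omega>\<^sup>2 * T)) *
           (THE z. \<exists>w. spectral_solution D I \<Phi> lam \<omega> T g v w \<and> z = w T) x)"

definition converges_in_span ::
  "'a set \<Rightarrow> 'k set \<Rightarrow> ('k \<Rightarrow> 'a \<Rightarrow> complex) \<Rightarrow> (nat \<Rightarrow> 'a \<Rightarrow> complex) \<Rightarrow> ('a \<Rightarrow> complex) \<Rightarrow> bool" where
  "converges_in_span D K \<Phi> v u \<longleftrightarrow>
     (\<exists>a b. (\<forall>n. expansion_on D K \<Phi> (a n) (v n)) \<and> expansion_on D K \<Phi> b u \<and>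
        (\<forall>k\<in>K. (\<lambda>n. a n k) \<longlonglongrightarrow> b k))"

end

theory Submission
  imports Defs
begin

text \<open>
  Along an eigenfunction \<open>\<Phi> k\<close> the evolution equation is the scalar equation
  \<open>w' - \<i> \<mu> w = \<i> \<gamma> exp (- \<i> \<omega>\<^sup>2 t)\<close>, where \<open>\<mu> = lam k\<close> and \<open>\<gamma> = gc k\<close>. Since
  \<open>Im \<mu> > 0\<close>, the number \<open>\<omega>\<^sup>2 + \<mu>\<close> is not zero, and there is exactly one time-harmonic
  solution \<open>\<beta> exp (- \<i> \<omega>\<^sup>2 t)\<close>, with amplitude \<open>\<beta> = - \<gamma> / (\<omega>\<^sup>2 + \<mu>)\<close>. Every other solution
  differs from it by a multiple of \<open>exp (\<i> \<mu> t)\<close>. After \<open>S_op\<close> has removed the phase at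
  time \<open>T\<close>, the deviation of a coefficient from \<open>\<beta>\<close> has been multiplied by
  \<open>r = exp (\<i> (\<omega>\<^sup>2 + \<mu>) T)\<close>, as \<open>S_op_expansion\<close> says. Because \<open>\<bar>r\<bar> = exp (- T Im \<mu>) < 1\<close>,
  the iteration is a contraction in every mode. Starting from \<open>0\<close>, its \<open>n\<close>-th coefficient is
  \<open>(1 - r ^ n) \<beta>\<close>, which tends to \<open>\<beta>\<close>.

  The function \<open>u = (\<Sum>k\<in>K. \<beta> k * \<Phi> k)\<close> solves the Helmholtz problem because
  \<open>\<omega>\<^sup>2 + H\<close> acts on the mode \<open>\<Phi> k\<close> as multiplication by \<open>\<omega>\<^sup>2 + lam k\<close>, and
  \<open>(\<omega>\<^sup>2 + lam k) \<beta> k = - gc k\<close>; this is \<open>helmholtz_of_mode_amplitudes\<close>. It rests on the linearity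
  of the classical derivatives and on the fact that they only see the values of \<open>u\<close> in the
  open domain.

  Both the operator \<open>S_op\<close>, a definite description over all spectral representations,
  and the notion of limit, which allows any choice of coefficients, require uniqueness. It
  follows from linear independence of the modes (\<open>expansion_coeff_unique\<close>) and from
  uniqueness for the scalar initial value problem (\<open>mode_solution_unique\<close>).
\<close>

section \<open>Linearity and locality of classical derivatives\<close>

lemma has_derivative_partial:
  assumes "open D" "x \<in> D" "f differentiable_on D"
  shows "(f has_derivative frechet_derivative f (at x)) (at x)"
  using assms
  by (metis at_within_open differentiable_on_def frechet_derivative_works)

lemma partial_cong:
  assumes "open D" "x \<in> D" "\<And>y. y \<in> D \<Longrightarrow> f y = g y"
  shows "partial b f x = partial b g x"
proof -
  have "(f has_derivative f') (at x) \<longleftrightarrow> (g has_derivative f') (at x)" for f'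
    using has_derivative_transform_within_open[OF _ assms(1,2)] assms(3) by metis
  then show ?thesis
    by (simp add: partial_def frechet_derivative_def)
qed

lemma Ck_on_cong:
  assumes "open D" "\<And>y. y \<in> D \<Longrightarrow> f y = g y" "Ck_on n D f"
  shows "Ck_on n D g"
  using assms(2,3)
proof (induction n arbitrary: f g)
  case 0
  then show ?case using continuous_on_cong by fastforce
next
  case (Suc n)
  have "g differentiable_on D"
    using Suc.prems differentiable_transform_within[OF _ zero_less_one]
    unfolding differentiable_on_def by (metis Ck_on.simps(2) differentiable_on_def)
  moreover have "Ck_on n D (partial b g)" if "b \<in> Basis" for b
    using Suc.IH[of "partial b f" "partial b g"] Suc.prems partial_cong[OF \<open>open D\<close>] that
    by (metis Ck_on.simps(2))
  ultimately show ?case by simp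
qed

lemma has_derivative_lincomb:
  fixes F :: "'k \<Rightarrow> 'a::euclidean_space \<Rightarrow> complex"
  assumes "\<And>k. k \<in> K \<Longrightarrow> (F k has_derivative F' k) (at x)"
  shows "((\<lambda>y. \<Sum>k\<in>K. a k * F k y) has_derivative (\<lambda>h. \<Sum>k\<in>K. a k * F' k h)) (at x)"
  using assms by (intro has_derivative_sum has_derivative_mult_right)

lemma partial_lincomb:
  fixes F :: "'k \<Rightarrow> 'a::euclidean_space \<Rightarrow> complex"
  assumes "open D" "x \<in> D" "\<And>k. k \<in> K \<Longrightarrow> F k differentiable_on D"
  shows "partial b (\<lambda>y. \<Sum>k\<in>K. a k * F k y) x = (\<Sum>k\<in>K. a k * partial b (F k) x)"
proof -
  have "((\<lambda>y. \<Sum>k\<in>K. a k * F k y) has_derivative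
      (\<lambda>h. \<Sum>k\<in>K. a k * frechet_derivative (F k) (at x) h)) (at x)"
    by (intro has_derivative_lincomb has_derivative_partial[OF assms])
  from fun_cong[OF frechet_derivative_at[OF this], of b] show ?thesis
    by (simp add: partial_def)
qed

lemma Ck_on_lincomb:
  fixes F :: "'k \<Rightarrow> 'a::euclidean_space \<Rightarrow> complex"
  assumes "open D" "\<And>k. k \<in> K \<Longrightarrow> Ck_on n D (F k)"
  shows "Ck_on n D (\<lambda>y. \<Sum>k\<in>K. a k * F k y)"
  using assms(2)
proof (induction n arbitrary: F)
  case 0
  then show ?case by (auto intro!: continuous_intros)
next
  case (Suc n)
  have dif: "F k differentiable_on D" if "k \<in> K" for k
    using Suc.prems that by simp
  have "(\<lambda>y. \<Sum>k\<in>K. a k * F k y) differentiable_on D"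
  proof (rule differentiable_at_imp_differentiable_on)
    show "(\<lambda>y. \<Sum>k\<in>K. a k * F k y) differentiable at x" if "x \<in> D" for x
      by (rule differentiableI, rule has_derivative_lincomb,
          rule has_derivative_partial[OF \<open>open D\<close> that dif])
  qed
  moreover have "Ck_on n D (partial b (\<lambda>y. \<Sum>k\<in>K. a k * F k y))" if "b \<in> Basis" for b
  proof (rule Ck_on_cong[OF \<open>open D\<close>])
    show "(\<Sum>k\<in>K. a k * partial b (F k) y) = partial b (\<lambda>y. \<Sum>k\<in>K. a k * F k y) y"
      if "y \<in> D" for y
      using partial_lincomb[of D y K F b a] \<open>open D\<close> that dif by simp
    show "Ck_on n D (\<lambda>y. \<Sum>k\<in>K. a k * partial b (F k) y)"
      using Suc.prems that by (intro Suc.IH) simp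
  qed
  ultimately show ?case by simp
qed

lemma laplacian_lincomb:
  fixes F :: "'k \<Rightarrow> 'a::euclidean_space \<Rightarrow> complex"
  assumes "open D" "x \<in> D" "\<And>k. k \<in> K \<Longrightarrow> Ck_on 2 D (F k)"
    and u: "\<And>y. y \<in> D \<Longrightarrow> u y = (\<Sum>k\<in>K. a k * F k y)"
  shows "laplacian u x = (\<Sum>k\<in>K. a k * laplacian (F k) x)"
proof -
  have C2: "F k differentiable_on D" "b \<in> Basis \<Longrightarrow> partial b (F k) differentiable_on D"
    if "k \<in> K" for k b
    using assms(3)[OF that] by (auto simp: numeral_2_eq_2)
  have "partial b (partial b u) x = (\<Sum>k\<in>K. a k * partial b (partial b (F k)) x)"
    if "b \<in> Basis" for b
  proof -
    have "partial b u y = (\<Sum>k\<in>K. a k * partial b (F k) y)" if "y \<in> D" for y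
      using partial_cong[of D y u "\<lambda>y. \<Sum>k\<in>K. a k * F k y" b] partial_lincomb[of D y K F b a]
        \<open>open D\<close> that u C2(1) by simp
    then have "partial b (partial b u) x = partial b (\<lambda>y. \<Sum>k\<in>K. a k * partial b (F k) y) x"
      by (rule partial_cong[OF assms(1,2)])
    also have "\<dots> = (\<Sum>k\<in>K. a k * partial b (partial b (F k)) x)"
      using partial_lincomb[of D x K "\<lambda>k. partial b (F k)" b a] assms(1,2) C2(2) that by simp
    finally show ?thesis .
  qed
  then show ?thesis
    unfolding laplacian_def sum_distrib_left by (subst sum.swap) simp
qed

lemma H_op_lincomb:
  fixes F :: "'k \<Rightarrow> 'a::euclidean_space \<Rightarrow> complex"
  assumes "open D" "x \<in> D" "\<And>k. k \<in> K \<Longrightarrow> Ck_on 2 D (F k)"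
    and "\<And>y. y \<in> D \<Longrightarrow> u y = (\<Sum>k\<in>K. a k * F k y)"
  shows "H_op c W u x = (\<Sum>k\<in>K. a k * H_op c W (F k) x)"
proof -
  have "laplacian u x = (\<Sum>k\<in>K. a k * laplacian (F k) x)"
    using assms by (rule laplacian_lincomb)
  then show ?thesis
    by (simp add: H_op_def assms(4)[OF \<open>x \<in> D\<close>] sum_distrib_left sum.distrib ring_distribs mult_ac)
qed

section \<open>Superposition of eigenfunctions\<close>

lemma dirichlet_function_lincomb:
  fixes F :: "'k \<Rightarrow> 'a::euclidean_space \<Rightarrow> complex"
  assumes "open D" "\<And>k. k \<in> K \<Longrightarrow> dirichlet_function D (F k)"
    and u: "expansion_on (closure D) K F a u"
  shows "dirichlet_function D u"
proof -
  have u': "u x = (\<Sum>k\<in>K. a k * F k x)" if "x \<in> closure D" for x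
    using u that by (simp add: expansion_on_def)
  have "Ck_on 2 D (\<lambda>x. \<Sum>k\<in>K. a k * F k x)"
    using assms by (intro Ck_on_lincomb) (auto simp: dirichlet_function_def)
  then have "Ck_on 2 D u"
    by (rule Ck_on_cong[OF \<open>open D\<close>, rotated]) (use u' closure_subset[of D] in auto)
  moreover have "continuous_on (closure D) (\<lambda>x. \<Sum>k\<in>K. a k * F k x)"
    using assms by (auto intro!: continuous_intros simp: dirichlet_function_def)
  then have "continuous_on (closure D) u"
    using u' by (simp cong: continuous_on_cong)
  moreover have "u x = 0" if "x \<in> frontier D" for x
    using u'[of x] assms(2) that by (simp add: dirichlet_function_def frontier_def)
  ultimately show ?thesis by (simp add: dirichlet_function_def)
qed

text \<open>The differential equation decouples: \<open>\<omega>\<^sup>2 + H\<close> is diagonal in the modes, so that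
  it only has to be solved for each amplitude.\<close>

lemma helmholtz_of_mode_amplitudes:
  fixes \<Phi> :: "'k \<Rightarrow> 'a::euclidean_space \<Rightarrow> complex"
  assumes "open D" "\<And>k. k \<in> K \<Longrightarrow> eigenfunction D c W (lam k) (\<Phi> k)"
    and g: "expansion_on D K \<Phi> gc g" and u: "expansion_on (closure D) K \<Phi> \<beta> u"
    and amp: "\<And>k. k \<in> K \<Longrightarrow> (of_real (\<omega>\<^sup>2) + lam k) * \<beta> k = - gc k"
  shows "solves_helmholtz D c W \<omega> g u"
  unfolding solves_helmholtz_def
proof (intro conjI ballI)
  have \<Phi>: "dirichlet_function D (\<Phi> k)" "Ck_on 2 D (\<Phi> k)" if "k \<in> K" for k
    using assms(2)[OF that] by (auto simp: eigenfunction_def dirichlet_function_def)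
  show "dirichlet_function D u"
    using dirichlet_function_lincomb[OF \<open>open D\<close> \<Phi>(1) u] .
  have u': "u x = (\<Sum>k\<in>K. \<beta> k * \<Phi> k x)" if "x \<in> D" for x
    using u that closure_subset by (force simp: expansion_on_def)
  fix x assume x: "x \<in> D"
  have "H_op c W u x = (\<Sum>k\<in>K. \<beta> k * H_op c W (\<Phi> k) x)"
    using H_op_lincomb[OF \<open>open D\<close> x \<Phi>(2) u'] .
  also have "\<dots> = (\<Sum>k\<in>K. \<beta> k * (lam k * \<Phi> k x))"
    using assms(2) x by (intro sum.cong) (auto simp: eigenfunction_def)
  finally have "of_real (\<omega>\<^sup>2) * u x + H_op c W u x
      = (\<Sum>k\<in>K. ((of_real (\<omega>\<^sup>2) + lam k) * \<beta> k) * \<Phi> k x)"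
    by (simp add: u'[OF x] sum_distrib_left sum.distrib[symmetric] algebra_simps)
  also have "\<dots> = - g x"
    using g x amp by (simp add: expansion_on_def sum_negf)
  finally show "of_real (\<omega>\<^sup>2) * u x + H_op c W u x = - g x" .
qed

text \<open>The two index sets may differ, because each spectral representation of a function may
  choose its own; a mode absent from one of them has coefficient \<open>0\<close> in the other.\<close>

lemma expansion_coeff_unique:
  assumes "lin_indep_on D I \<Phi>"
    and "finite K" "K \<subseteq> I" "expansion_on D K \<Phi> a f"
    and "finite L" "L \<subseteq> I" "expansion_on D L \<Phi> b f"
  shows "(if k \<in> K then a k else 0) = (if k \<in> L then b k else 0)"
proof (cases "k \<in> K \<union> L")
  case True
  let ?d = "\<lambda>k. (if k \<in> K then a k else 0) - (if k \<in> L then b k else 0)"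
  have "(\<Sum>k\<in>K \<union> L. ?d k * \<Phi> k x) = 0" if "x \<in> D" for x
  proof -
    have "(\<Sum>k\<in>K \<union> L. (if k \<in> K then a k else 0) * \<Phi> k x) = (\<Sum>k\<in>K. a k * \<Phi> k x)"
      using assms by (intro sum.mono_neutral_cong_right) auto
    moreover have "(\<Sum>k\<in>K \<union> L. (if k \<in> L then b k else 0) * \<Phi> k x) = (\<Sum>k\<in>L. b k * \<Phi> k x)"
      using assms by (intro sum.mono_neutral_cong_right) auto
    ultimately show ?thesis
      using assms(4,7) that by (simp add: left_diff_distrib sum_subtractf expansion_on_def)
  qed
  moreover have "finite (K \<union> L)" "K \<union> L \<subseteq> I"
    using assms by auto
  ultimately have "\<forall>k\<in>K \<union> L. ?d k = 0"
    using assms(1)[unfolded lin_indep_on_def, rule_format, of "K \<union> L" ?d] by blast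
  with True show ?thesis by simp
qed simp

section \<open>The scalar equation of one mode\<close>

definition mode_solution ::
  "complex \<Rightarrow> real \<Rightarrow> real \<Rightarrow> complex \<Rightarrow> complex \<Rightarrow> (real \<Rightarrow> complex) \<Rightarrow> bool" where
  "mode_solution \<mu> \<omega> T \<gamma> z w \<longleftrightarrow> continuous_on {0..T} w \<and> w 0 = z \<and>
     (\<forall>t\<in>{0<..<T}. \<exists>w'. (w has_vector_derivative w') (at t) \<and>
        w' - \<i> * \<mu> * w t = \<i> * \<gamma> * exp (- (\<i> * of_real (\<omega>\<^sup>2 * t))))"

lemma spectral_solution_iff_modes:
  "spectral_solution D I \<Phi> lam \<omega> T g v w \<longleftrightarrow>
     (\<exists>K gc vc wc. finite K \<and> K \<subseteq> I \<and> expansion_on D K \<Phi> gc g \<and> expansion_on D K \<Phi> vc v \<and>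
        (\<forall>k\<in>K. mode_solution (lam k) \<omega> T (gc k) (vc k) (wc k)) \<and>
        (\<forall>t\<in>{0..T}. expansion_on UNIV K \<Phi> (\<lambda>k. wc k t) (w t)))"
  by (simp add: spectral_solution_def mode_solution_def)

lemma has_vector_derivative_exp_linear:
  "((\<lambda>t. exp (a * of_real t)) has_vector_derivative a * exp (a * of_real t)) (at t within S)"
  for a :: complex
proof -
  have "((\<lambda>z. exp (a * z)) has_field_derivative a * exp (a * of_real t)) (at (of_real t))"
    by (auto intro!: derivative_eq_intros)
  from has_vector_derivative_real_field[OF this] show ?thesis by simp
qed

text \<open>The integrating factor \<open>exp (- \<i> \<mu> t)\<close> turns the difference of two solutions into a
  function with derivative zero.\<close>

lemma mode_solution_unique:
  assumes "mode_solution \<mu> \<omega> T \<gamma> z w1" "mode_solution \<mu> \<omega> T \<gamma> z w2" "t \<in> {0..T}"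
  shows "w1 t = w2 t"
proof -
  let ?f = "\<lambda>t. exp (- \<i> * \<mu> * of_real t) * (w1 t - w2 t)"
  have "continuous_on {0..T} ?f"
    using assms by (auto simp: mode_solution_def intro!: continuous_intros)
  moreover have "?f 0 = 0"
    using assms by (simp add: mode_solution_def)
  \<comment> \<open>The equation holds only inside the interval; continuity takes care of the endpoints.\<close>
  moreover have "(?f has_derivative (\<lambda>h. 0)) (at s within {0..T})" if "s \<in> {0..T} - {0, T}" for s
  proof -
    have "s \<in> {0<..<T}" using that by auto
    then obtain d1 d2 where
      d1: "(w1 has_vector_derivative d1) (at s)"
        "d1 - \<i> * \<mu> * w1 s = \<i> * \<gamma> * exp (- (\<i> * of_real (\<omega>\<^sup>2 * s)))" and
      d2: "(w2 has_vector_derivative d2) (at s)"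
        "d2 - \<i> * \<mu> * w2 s = \<i> * \<gamma> * exp (- (\<i> * of_real (\<omega>\<^sup>2 * s)))"
      using assms(1,2) unfolding mode_solution_def by meson
    have "(?f has_vector_derivative
        exp (- \<i> * \<mu> * of_real s) * (d1 - d2) +
        (- \<i> * \<mu> * exp (- \<i> * \<mu> * of_real s)) * (w1 s - w2 s)) (at s)"
      by (intro has_vector_derivative_mult has_vector_derivative_diff
          has_vector_derivative_exp_linear d1(1) d2(1))
    moreover have "exp (- \<i> * \<mu> * of_real s) * (d1 - d2) +
        (- \<i> * \<mu> * exp (- \<i> * \<mu> * of_real s)) * (w1 s - w2 s)
        = exp (- \<i> * \<mu> * of_real s) * ((d1 - \<i> * \<mu> * w1 s) - (d2 - \<i> * \<mu> * w2 s))"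
      by (simp add: algebra_simps)
    ultimately have "(?f has_vector_derivative 0) (at s)"
      using d1(2) d2(2) by simp
    then show ?thesis
      by (simp add: has_vector_derivative_def has_derivative_at_withinI)
  qed
  ultimately have "?f t = 0"
    using has_derivative_zero_unique_strong_interval[of "{0, T}" 0 T ?f 0 t] assms(3) by blast
  then show ?thesis by simp
qed

lemma mode_solution_explicit:
  assumes "(of_real (\<omega>\<^sup>2) + \<mu>) * \<beta> = - \<gamma>"
  shows "mode_solution \<mu> \<omega> T \<gamma> z
    (\<lambda>t. \<beta> * exp (- \<i> * of_real (\<omega>\<^sup>2) * of_real t) + (z - \<beta>) * exp (\<i> * \<mu> * of_real t))"
    (is "mode_solution _ _ _ _ _ ?w")
  unfolding mode_solution_def
proof (intro conjI ballI)
  show "continuous_on {0..T} ?w" by (intro continuous_intros)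
  show "?w 0 = z" by simp
  fix t
  let ?e = "exp (- \<i> * of_real (\<omega>\<^sup>2) * of_real t)"
  let ?d = "\<beta> * (- \<i> * of_real (\<omega>\<^sup>2) * ?e) + (z - \<beta>) * (\<i> * \<mu> * exp (\<i> * \<mu> * of_real t))"
  have "(?w has_vector_derivative ?d) (at t)"
    by (intro has_vector_derivative_add has_vector_derivative_mult_right
        has_vector_derivative_exp_linear)
  moreover have "?d - \<i> * \<mu> * ?w t = - \<i> * ((of_real (\<omega>\<^sup>2) + \<mu>) * \<beta>) * ?e"
    by (simp add: algebra_simps)
  then have "?d - \<i> * \<mu> * ?w t = \<i> * \<gamma> * exp (- (\<i> * of_real (\<omega>\<^sup>2 * t)))"
    unfolding assms by (simp add: mult.assoc)
  ultimately show "\<exists>w'. (?w has_vector_derivative w') (at t) \<and>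
      w' - \<i> * \<mu> * ?w t = \<i> * \<gamma> * exp (- (\<i> * of_real (\<omega>\<^sup>2 * t)))"
    by blast
qed

section \<open>One step of the iteration\<close>

text \<open>Two representations may use different index sets. A mode outside the intersection
  has zero source and zero initial value, hence stays zero and does not contribute.\<close>

lemma spectral_solution_unique:
  assumes "lin_indep_on D I \<Phi>" "0 \<le> T"
    and "spectral_solution D I \<Phi> lam \<omega> T g v w1" "spectral_solution D I \<Phi> lam \<omega> T g v w2"
  shows "w1 T = w2 T"
proof -
  obtain K g1 v1 c1 where 1: "finite K" "K \<subseteq> I" "expansion_on D K \<Phi> g1 g"
    "expansion_on D K \<Phi> v1 v" "\<And>k. k \<in> K \<Longrightarrow> mode_solution (lam k) \<omega> T (g1 k) (v1 k) (c1 k)"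
    "\<forall>t\<in>{0..T}. expansion_on UNIV K \<Phi> (\<lambda>k. c1 k t) (w1 t)"
    using assms(3) unfolding spectral_solution_iff_modes by blast
  obtain L g2 v2 c2 where 2: "finite L" "L \<subseteq> I" "expansion_on D L \<Phi> g2 g"
    "expansion_on D L \<Phi> v2 v" "\<And>k. k \<in> L \<Longrightarrow> mode_solution (lam k) \<omega> T (g2 k) (v2 k) (c2 k)"
    "\<forall>t\<in>{0..T}. expansion_on UNIV L \<Phi> (\<lambda>k. c2 k t) (w2 t)"
    using assms(4) unfolding spectral_solution_iff_modes by blast
  note eq_g = expansion_coeff_unique[OF assms(1) 1(1-3) 2(1-3)]
    and eq_v = expansion_coeff_unique[OF assms(1) 1(1,2,4) 2(1,2,4)]
  have T: "T \<in> {0..T}" using assms(2) by simp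
  have zero: "mode_solution \<mu> \<omega> T 0 0 (\<lambda>t. 0)" for \<mu>
    using mode_solution_explicit[of \<omega> \<mu> 0 0 T 0] by simp
  have eq: "c1 k T = c2 k T" if "k \<in> K \<inter> L" for k
    using mode_solution_unique[OF 1(5) _ T] 2(5)[of k] eq_g[of k] eq_v[of k] that by auto
  have "c1 k T = 0" if "k \<in> K - L" for k
    using mode_solution_unique[OF 1(5) _ T] zero eq_g[of k] eq_v[of k] that by fastforce
  then have "w1 T x = (\<Sum>k\<in>K \<inter> L. c1 k T * \<Phi> k x)" for x
    using 1(1,6) T by (simp add: expansion_on_def) (intro sum.mono_neutral_right, auto)
  moreover have "c2 k T = 0" if "k \<in> L - K" for k
    using mode_solution_unique[OF 2(5) _ T] zero eq_g[of k] eq_v[of k] that by fastforce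
  then have "w2 T x = (\<Sum>k\<in>K \<inter> L. c2 k T * \<Phi> k x)" for x
    using 2(1,6) T by (simp add: expansion_on_def) (intro sum.mono_neutral_right, auto)
  ultimately show ?thesis using eq by auto
qed

text \<open>Conjugation with the phase \<open>exp (- \<i> \<omega>\<^sup>2 t)\<close> makes the forced oscillation of amplitude
  \<open>\<beta> k\<close> stationary, so that a step is an affine map in each mode, with fixed point \<open>\<beta> k\<close>.\<close>

lemma S_op_expansion:
  assumes "lin_indep_on D I \<Phi>" "0 \<le> T" "finite K" "K \<subseteq> I"
    and g: "expansion_on D K \<Phi> gc g" and v: "expansion_on D K \<Phi> vc v"
    and amp: "\<And>k. k \<in> K \<Longrightarrow> (of_real (\<omega>\<^sup>2) + lam k) * \<beta> k = - gc k"
  shows "S_op D I \<Phi> lam \<omega> T g v =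
    (\<lambda>x. \<Sum>k\<in>K. (\<beta> k + exp (\<i> * (of_real (\<omega>\<^sup>2) + lam k) * of_real T) * (vc k - \<beta> k)) * \<Phi> k x)"
proof -
  define wc where "wc k t = \<beta> k * exp (- \<i> * of_real (\<omega>\<^sup>2) * of_real t)
    + (vc k - \<beta> k) * exp (\<i> * lam k * of_real t)" for k and t :: real
  define w where "w t x = (\<Sum>k\<in>K. wc k t * \<Phi> k x)" for t x
  have "mode_solution (lam k) \<omega> T (gc k) (vc k) (wc k)" if "k \<in> K" for k
    using mode_solution_explicit[OF amp[OF that]] unfolding wc_def .
  then have sol: "spectral_solution D I \<Phi> lam \<omega> T g v w"
    unfolding spectral_solution_iff_modes using assms
    by (intro exI[of _ K] exI[of _ gc] exI[of _ vc] exI[of _ wc])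
      (auto simp: w_def expansion_on_def)
  have "(THE z. \<exists>w. spectral_solution D I \<Phi> lam \<omega> T g v w \<and> z = w T) = w T"
    using sol spectral_solution_unique[OF assms(1,2)] by (intro the_equality) blast+
  moreover have "exp (\<i> * of_real (\<omega>\<^sup>2 * T)) * wc k T
      = \<beta> k + exp (\<i> * (of_real (\<omega>\<^sup>2) + lam k) * of_real T) * (vc k - \<beta> k)" for k
  proof -
    have "exp (\<i> * of_real (\<omega>\<^sup>2 * T)) * exp (- \<i> * of_real (\<omega>\<^sup>2) * of_real T) = 1"
      unfolding exp_add[symmetric] by simp
    moreover have "exp (\<i> * of_real (\<omega>\<^sup>2 * T)) * exp (\<i> * lam k * of_real T)
        = exp (\<i> * (of_real (\<omega>\<^sup>2) + lam k) * of_real T)"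
      unfolding exp_add[symmetric] by (simp add: algebra_simps)
    moreover have "p * (\<beta> k * q + (vc k - \<beta> k) * s) = \<beta> k * (p * q) + p * s * (vc k - \<beta> k)"
      for p q s
      by (simp add: algebra_simps)
    ultimately show ?thesis
      unfolding wc_def by (simp only: mult_1_right)
  qed
  ultimately show ?thesis
    unfolding S_op_def w_def by (simp add: sum_distrib_left mult.assoc[symmetric])
qed

section \<open>Convergence of the iteration\<close>

theorem theorem2p2:
  fixes \<Omega> \<Omega>s :: "'a::euclidean_space set"
    and c W :: "'a \<Rightarrow> real"
    and I K :: "'k set"
    and \<Phi> :: "'k \<Rightarrow> 'a \<Rightarrow> complex"
    and lam gc :: "'k \<Rightarrow> complex"
    and g :: "'a \<Rightarrow> complex"
    and v :: "nat \<Rightarrow> 'a \<Rightarrow> complex"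
    and \<omega> T :: real
  assumes "is_domain \<Omega>" and "is_domain \<Omega>s" and "bounded \<Omega>s" and "\<Omega> \<subseteq> \<Omega>s"
    and "\<And>x. x \<in> \<Omega>s \<Longrightarrow> 0 < c x"
    and "smooth_on \<Omega>s W" and "\<And>x. x \<in> \<Omega>s \<Longrightarrow> 0 \<le> W x" and "\<And>x. x \<in> \<Omega> \<Longrightarrow> W x = 0"
    and "\<And>k. k \<in> I \<Longrightarrow> eigenfunction \<Omega>s c W (lam k) (\<Phi> k)"
    and "lin_indep_on \<Omega>s I \<Phi>"
    and "0 < \<omega>" and "0 < T"
    and "finite K" and "K \<subseteq> I" and "expansion_on \<Omega>s K \<Phi> gc g"
    and "K \<noteq> {} \<Longrightarrow> 0 < lambda_star K lam"
    and "v 0 = (\<lambda>x. 0)"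
    and "\<And>n. v (Suc n) = S_op \<Omega>s I \<Phi> lam \<omega> T g (v n)"
  shows "(\<exists>u. converges_in_span (closure \<Omega>s) K \<Phi> v u) \<and>
         (\<forall>u. converges_in_span (closure \<Omega>s) K \<Phi> v u \<longrightarrow> solves_helmholtz \<Omega>s c W \<omega> g u)"
proof -
  have "open \<Omega>s" using assms(2) by (simp add: is_domain_def)
  have Im_pos: "0 < Im (lam k)" if "k \<in> K" for k
  proof -
    have "lambda_star K lam \<le> Im (lam k)"
      unfolding lambda_star_def using \<open>finite K\<close> that by simp
    then show ?thesis using assms(16) that by fastforce
  qed
  define \<beta> where "\<beta> k = - gc k / (of_real (\<omega>\<^sup>2) + lam k)" for k
  define r where "r k = exp (\<i> * (of_real (\<omega>\<^sup>2) + lam k) * of_real T)" for k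
  have amp: "(of_real (\<omega>\<^sup>2) + lam k) * \<beta> k = - gc k" if "k \<in> K" for k
  proof -
    \<comment> \<open>Without absorption the mode could be in resonance with the frequency \<open>\<omega>\<close>.\<close>
    have "Im (of_real (\<omega>\<^sup>2) + lam k) \<noteq> 0" using Im_pos[OF that] by simp
    then have "of_real (\<omega>\<^sup>2) + lam k \<noteq> 0" by (metis zero_complex.simps(2))
    then show ?thesis by (simp add: \<beta>_def)
  qed
  have contraction: "norm (r k) < 1" if "k \<in> K" for k
    using Im_pos[OF that] \<open>0 < T\<close> by (simp add: r_def)
  have v: "v n = (\<lambda>x. \<Sum>k\<in>K. ((1 - r k ^ n) * \<beta> k) * \<Phi> k x)" for n
  proof (induction n)
    case 0
    then show ?case using assms(17) by simp
  next
    case (Suc n)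
    have "expansion_on \<Omega>s K \<Phi> (\<lambda>k. (1 - r k ^ n) * \<beta> k) (v n)"
      by (simp add: Suc expansion_on_def)
    from S_op_expansion[OF assms(10) less_imp_le[OF \<open>0 < T\<close>] assms(13-15) this amp]
    show ?case
      unfolding assms(18) r_def[symmetric]
      by (simp add: algebra_simps)
  qed
  have lim: "(\<lambda>n. (1 - r k ^ n) * \<beta> k) \<longlonglongrightarrow> \<beta> k" if "k \<in> K" for k
    using tendsto_mult[OF tendsto_diff[OF tendsto_const LIMSEQ_power_zero[OF contraction[OF that]]]
        tendsto_const, of 1 "\<beta> k"] by simp
  show ?thesis
  proof (intro conjI allI impI)
    show "\<exists>u. converges_in_span (closure \<Omega>s) K \<Phi> v u"
      unfolding converges_in_span_def expansion_on_def
      using v lim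
      by (intro exI[of _ "\<lambda>x. \<Sum>k\<in>K. \<beta> k * \<Phi> k x"]
          exI[of _ "\<lambda>n k. (1 - r k ^ n) * \<beta> k"] exI[of _ \<beta>]) simp
  next
    fix u assume "converges_in_span (closure \<Omega>s) K \<Phi> v u"
    then obtain a b where a: "\<And>n. expansion_on (closure \<Omega>s) K \<Phi> (a n) (v n)"
      and b: "expansion_on (closure \<Omega>s) K \<Phi> b u"
      and ab: "\<And>k. k \<in> K \<Longrightarrow> (\<lambda>n. a n k) \<longlonglongrightarrow> b k"
      unfolding converges_in_span_def by blast
    \<comment> \<open>The coefficients in the definition of the limit are arbitrary representations; linear
      independence forces them to be those computed above.\<close>
    have "b k = \<beta> k" if "k \<in> K" for k
    proof -
      have "a n k = (1 - r k ^ n) * \<beta> k" for n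
      proof -
        have "expansion_on \<Omega>s K \<Phi> (a n) (v n)"
          using a[of n] closure_subset[of \<Omega>s] by (auto simp: expansion_on_def)
        moreover have "expansion_on \<Omega>s K \<Phi> (\<lambda>k. (1 - r k ^ n) * \<beta> k) (v n)"
          by (simp add: v expansion_on_def)
        ultimately have "(if k \<in> K then a n k else 0) = (if k \<in> K then (1 - r k ^ n) * \<beta> k else 0)"
          by (rule expansion_coeff_unique[OF assms(10,13,14) _ assms(13,14)])
        with that show ?thesis by simp
      qed
      then show ?thesis
        using ab[OF that] lim[OF that] by (simp add: LIMSEQ_unique)
    qed
    then have "(of_real (\<omega>\<^sup>2) + lam k) * b k = - gc k" if "k \<in> K" for k
      using amp that by simp
    moreover have "eigenfunction \<Omega>s c W (lam k) (\<Phi> k)" if "k \<in> K" for k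
      using assms(9,14) that by blast
    ultimately show "solves_helmholtz \<Omega>s c W \<omega> g u"
      using helmholtz_of_mode_amplitudes[OF \<open>open \<Omega>s\<close> _ assms(15) b] by blast
  qed
qed

end
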